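(* There exists a multiple unicast instance with three unit-entropy sessions and connectivity level $[2~3~2]$ that is infeasible.
   Context: A network is a finite directed acyclic graph $G=(V,E)$ (parallel edges allowed) in which every edge has unit capacity. A multiple unicast instance with $n$ sessions consists of $G$ together with source nodes $s_1,\dots,s_n$ and terminal nodes $t_1,\dots,t_n$ in $V$; source nodes have no incoming edges and terminal nodes have no outgoing edges; different sources (or terminals) may be collocated at the same node. Each $s_i$ observes a unit-entropy message to be communicated to $t_i$. The connectivity level is the vector $[k_1~\dots~k_n]$ where $k_i$ is the maximum flow from $s_i$ to $t_i$ in $G$. Coding strategies (possibly nonlinear): for a finite alphabet $\mathcal{X}$ with $|\mathcal{X}|\ge 2$ and block length $T$, the unit-entropy messages are independent and uniformly distributed on $\mathcal{X}^T$; each edge carries an element of $\mathcal{X}^T$ which is an arbitrary function of what is carried on the incoming edges of its tail and of the messages observed at its tail; each terminal $t_i$ estimates the message of $s_i$ by an arbitrary function of what is carried on its incoming edges. The instance is infeasible if, for every such alphabet $\mathcal{X}$, there is no sequence of such codes with $T\to\infty$ for which the probability that some terminal decodes incorrectly tends to $0$ (in particular, there is no zero-error code, linear or nonlinear, for any $T$). *)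

theory Defs
  imports "HOL-Probability.Probability" "Graph_Theory.Digraph"
begin

text \<open>Arcs are separate objects with a tail and a head, so parallel edges are allowed;
  \<^term>\<open>acyclic\<close> also rules out loops.\<close>

locale network = fin_digraph G for G :: "('v, 'e) pre_digraph" +
  assumes acyclic_arcs: "acyclic (arcs_ends G)"

text \<open>The sessions are numbered \<open>0, \<dots>, n - 1\<close>. The maps \<open>s\<close> and \<open>t\<close> need not be
  injective: sources (or terminals) may be collocated.\<close>

locale multiple_unicast = network G for G :: "('v, 'e) pre_digraph" +
  fixes n :: nat and s t :: "nat \<Rightarrow> 'v"
  assumes source_in_verts: "i < n \<Longrightarrow> s i \<in> verts G"
    and terminal_in_verts: "i < n \<Longrightarrow> t i \<in> verts G"
    and source_no_in_arcs: "i < n \<Longrightarrow> in_arcs G (s i) = {}"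
    and terminal_no_out_arcs: "i < n \<Longrightarrow> out_arcs G (t i) = {}"

definition is_flow :: "('v, 'e) pre_digraph \<Rightarrow> 'v \<Rightarrow> 'v \<Rightarrow> ('e \<Rightarrow> real) \<Rightarrow> bool" where
  "is_flow G u v f \<longleftrightarrow>
     (\<forall>e\<in>arcs G. 0 \<le> f e \<and> f e \<le> 1) \<and>
     (\<forall>w\<in>verts G - {u, v}. sum f (in_arcs G w) = sum f (out_arcs G w))"

definition flow_value :: "('v, 'e) pre_digraph \<Rightarrow> 'v \<Rightarrow> ('e \<Rightarrow> real) \<Rightarrow> real" where
  "flow_value G u f = sum f (out_arcs G u) - sum f (in_arcs G u)"

definition max_flow :: "('v, 'e) pre_digraph \<Rightarrow> 'v \<Rightarrow> 'v \<Rightarrow> real" where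
  "max_flow G u v = Sup {flow_value G u f | f. is_flow G u v f}"

definition connectivity_level ::
  "('v, 'e) pre_digraph \<Rightarrow> nat \<Rightarrow> (nat \<Rightarrow> 'v) \<Rightarrow> (nat \<Rightarrow> 'v) \<Rightarrow> real list" where
  "connectivity_level G n s t = map (\<lambda>i. max_flow G (s i) (t i)) [0..<n]"

text \<open>Alphabets are finite sets of natural numbers, which up to renaming of the symbols covers
  every finite alphabet. This allows the alphabet to be quantified inside a formula.\<close>

definition blocks :: "nat set \<Rightarrow> nat \<Rightarrow> nat list set" where
  "blocks X T = {w. set w \<subseteq> X \<and> length w = T}"

text \<open>\<open>enc C e\<close> takes what is carried on the incoming edges of the tail of \<open>e\<close> and the messages
  observed there; \<open>dec C i\<close> takes what is carried on the incoming edges of terminal \<open>i\<close>.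
  Locality is imposed below by restricting the arguments that these functions receive.\<close>

record 'e code =
  enc :: "'e \<Rightarrow> ('e \<Rightarrow> nat list) \<Rightarrow> (nat \<Rightarrow> nat list) \<Rightarrow> nat list"
  dec :: "nat \<Rightarrow> ('e \<Rightarrow> nat list) \<Rightarrow> nat list"

definition observed :: "nat \<Rightarrow> (nat \<Rightarrow> 'v) \<Rightarrow> 'v \<Rightarrow> nat set" where
  "observed n s v = {i. i < n \<and> s i = v}"

definition is_code ::
  "('v, 'e) pre_digraph \<Rightarrow> nat \<Rightarrow> (nat \<Rightarrow> 'v) \<Rightarrow> nat set \<Rightarrow> nat \<Rightarrow> 'e code \<Rightarrow> bool" where
  "is_code G n s X T C \<longleftrightarrow>
     (\<forall>e\<in>arcs G.
        \<forall>y \<in> in_arcs G (tail G e) \<rightarrow>\<^sub>E blocks X T.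
        \<forall>m \<in> observed n s (tail G e) \<rightarrow>\<^sub>E blocks X T.
          enc C e y m \<in> blocks X T)"

definition transmits ::
  "('v, 'e) pre_digraph \<Rightarrow> nat \<Rightarrow> (nat \<Rightarrow> 'v) \<Rightarrow> 'e code \<Rightarrow>
     (nat \<Rightarrow> nat list) \<Rightarrow> ('e \<Rightarrow> nat list) \<Rightarrow> bool" where
  "transmits G n s C m y \<longleftrightarrow>
     y \<in> extensional (arcs G) \<and>
     (\<forall>e\<in>arcs G. y e = enc C e (restrict y (in_arcs G (tail G e)))
                               (restrict m (observed n s (tail G e))))"

text \<open>Well-defined on a network: see \<open>transmits_unique\<close> and \<open>transmits_carried\<close>.\<close>

definition carried ::
  "('v, 'e) pre_digraph \<Rightarrow> nat \<Rightarrow> (nat \<Rightarrow> 'v) \<Rightarrow> 'e code \<Rightarrow>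
     (nat \<Rightarrow> nat list) \<Rightarrow> 'e \<Rightarrow> nat list" where
  "carried G n s C m = (THE y. transmits G n s C m y)"

lemma (in network) wf_arcs_ends: "wf (arcs_ends G)"
  using acyclic_arcs by (intro finite_acyclic_wf) (simp_all add: arcs_ends_def)

lemma (in network) transmits_unique: "\<exists>!y. transmits G n s C m y"
proof -
  let ?R = "inv_image (arcs_ends G) (tail G)"
  have wf: "wf ?R"
    by (rule wf_inv_image[OF wf_arcs_ends])
  have R: "(e', e) \<in> ?R" if "e' \<in> in_arcs G (tail G e)" for e e'
    using that by (auto simp: arcs_ends_conv image_iff)
  define F where "F = (\<lambda>f e. enc C e (restrict f (in_arcs G (tail G e)))
                                      (restrict m (observed n s (tail G e))))"
  define z where "z = wfrec ?R F"
  have z: "z e = F z e" for e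
  proof -
    have "z e = F (cut z ?R e) e"
      unfolding z_def by (rule wfrec[OF wf])
    also have "restrict (cut z ?R e) (in_arcs G (tail G e)) = restrict z (in_arcs G (tail G e))"
      using R by (intro restrict_ext) (simp add: cut_apply)
    then have "F (cut z ?R e) e = F z e"
      by (simp add: F_def)
    finally show ?thesis .
  qed
  have sub: "in_arcs G v \<subseteq> arcs G" for v
    by auto
  show ?thesis
  proof
    show "transmits G n s C m (restrict z (arcs G))"
      using z sub by (auto simp: transmits_def F_def Int_absorb1)
  next
    fix y assume y: "transmits G n s C m y"
    have "e \<in> arcs G \<longrightarrow> y e = z e" for e
      using wf
    proof (induction e rule: wf_induct_rule)
      case (less e)
      have "restrict y (in_arcs G (tail G e)) = restrict z (in_arcs G (tail G e))"
        using less R sub by (intro restrict_ext) blast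
      then show ?case
        using y z[of e] by (simp add: transmits_def F_def)
    qed
    then show "y = restrict z (arcs G)"
      using y by (auto simp: transmits_def extensional_def restrict_def)
  qed
qed

lemma (in network) transmits_carried: "transmits G n s C m (carried G n s C m)"
  unfolding carried_def by (rule theI'[OF transmits_unique])

definition message_pmf :: "nat \<Rightarrow> nat set \<Rightarrow> nat \<Rightarrow> (nat \<Rightarrow> nat list) pmf" where
  "message_pmf n X T = Pi_pmf {..<n} undefined (\<lambda>_. pmf_of_set (blocks X T))"

definition error_prob ::
  "('v, 'e) pre_digraph \<Rightarrow> nat \<Rightarrow> (nat \<Rightarrow> 'v) \<Rightarrow> (nat \<Rightarrow> 'v) \<Rightarrow>
     nat set \<Rightarrow> nat \<Rightarrow> 'e code \<Rightarrow> real" where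
  "error_prob G n s t X T C =
     measure_pmf.prob (message_pmf n X T)
       {m. \<exists>i<n. dec C i (restrict (carried G n s C m) (in_arcs G (t i))) \<noteq> m i}"

definition infeasible ::
  "('v, 'e) pre_digraph \<Rightarrow> nat \<Rightarrow> (nat \<Rightarrow> 'v) \<Rightarrow> (nat \<Rightarrow> 'v) \<Rightarrow> bool" where
  "infeasible G n s t \<longleftrightarrow>
     (\<forall>X. finite X \<and> card X \<ge> 2 \<longrightarrow>
        \<not> (\<exists>(T :: nat \<Rightarrow> nat) C.
              filterlim T at_top sequentially \<and>
              (\<forall>k. is_code G n s X (T k) (C k)) \<and>
              (\<lambda>k. error_prob G n s t X (T k) (C k)) \<longlonglongrightarrow> 0))"

end

theory Submission
  imports Defs
begin

text \<open>Sessions 1 and 3 share their source and their terminal; write \<open>k\<close> for their pair of messages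
  and \<open>b\<close> for the message of session 2. Four bottleneck arcs carry \<open>p0(k, b)\<close>, \<open>p1(p0, b)\<close>,
  \<open>p2(k, p1)\<close> and \<open>p3(p2, b)\<close>; \<open>k\<close> is decoded from \<open>p1, p3\<close>, and \<open>b\<close> from \<open>p0, p2, p3\<close>.
  Since \<open>p1, p3\<close> take no more values than \<open>k\<close>, decoding forces them, and hence \<open>p2\<close>, to be functions
  of \<open>k\<close>. For fixed \<open>b\<close>, \<open>p3\<close> is a function of \<open>p2\<close>; as neither depends on \<open>b\<close>, this is one function
  for all \<open>b\<close>. So \<open>p0, p2\<close> determine \<open>p3\<close>, therefore \<open>b\<close>, then \<open>p1\<close>, and finally \<open>k\<close>: two arcs
  carry three messages. Counting the messages lost at each step makes this robust against errors and
  shows that every code errs with probability at least 1/8.\<close>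

section \<open>Counting lost messages in an abstract coding scheme\<close>

lemma exists_large_fibre:
  assumes "finite M" "M \<noteq> {}" "finite K" "G \<subseteq> K \<times> M"
  obtains b where "b \<in> M" "card G \<le> card M * card {k. (k, b) \<in> G}"
proof (rule ccontr)
  assume *: "\<not> thesis"
  have fin: "finite {k. (k, b) \<in> G}" for b
    by (rule finite_subset[OF _ assms(3)]) (use assms(4) in auto)
  have "G = prod.swap ` (SIGMA b:M. {k. (k, b) \<in> G})"
    using assms(4) by (force simp: image_iff)
  then have "card G = card (SIGMA b:M. {k. (k, b) \<in> G})"
    by (metis card_image inj_swap)
  also have "\<dots> = (\<Sum>b\<in>M. card {k. (k, b) \<in> G})"
    using assms(1) fin by simp
  finally have card_G: "card G = (\<Sum>b\<in>M. card {k. (k, b) \<in> G})" .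
  \<comment> \<open>Averaging: if every fibre had fewer than \<open>card G / card M\<close>
    elements, the fibres could not add up to \<open>card G\<close>. Scaling by \<open>card M\<close>
    avoids division.\<close>
  have "card M * card G = (\<Sum>b\<in>M. card M * card {k. (k, b) \<in> G})"
    by (simp add: card_G sum_distrib_left)
  also have "\<dots> < (\<Sum>b\<in>M. card G)"
  proof (rule sum_strict_mono)
    fix b assume "b \<in> M"
    then show "card M * card {k. (k, b) \<in> G} < card G"
      using * that by (meson not_le)
  qed (use assms in auto)
  finally show False by simp
qed

text \<open>Only functional dependencies survive from the network. All of them are stated on
  \<open>good\<close>, which stands for the correctly decoded messages, because decoding can be
  relied on only there.\<close>

locale coding_scheme =
  fixes K :: "'k set" and M :: "'a set"
    and good :: "('k \<times> 'a) set"
    and p0 p1 p2 p3 :: "'k \<times> 'a \<Rightarrow> 'a"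
  assumes finite_K: "finite K" and finite_M: "finite M"
    and card_K: "card K = card M ^ 2" and M_nonempty: "M \<noteq> {}"
    and good_subset: "good \<subseteq> K \<times> M"
    and p_in_M: "\<And>x. x \<in> K \<times> M \<Longrightarrow> p0 x \<in> M \<and> p1 x \<in> M \<and> p2 x \<in> M \<and> p3 x \<in> M"
    and p1_cong: "\<And>x y. \<lbrakk>x \<in> good; y \<in> good; p0 x = p0 y; snd x = snd y\<rbrakk> \<Longrightarrow> p1 x = p1 y"
    and p2_cong: "\<And>x y. \<lbrakk>x \<in> good; y \<in> good; p1 x = p1 y; fst x = fst y\<rbrakk> \<Longrightarrow> p2 x = p2 y"
    and p3_cong: "\<And>x y. \<lbrakk>x \<in> good; y \<in> good; p2 x = p2 y; snd x = snd y\<rbrakk> \<Longrightarrow> p3 x = p3 y"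
    and decode_fst: "\<And>x y. \<lbrakk>x \<in> good; y \<in> good; p1 x = p1 y; p3 x = p3 y\<rbrakk> \<Longrightarrow> fst x = fst y"
    and decode_snd: "\<And>x y. \<lbrakk>x \<in> good; y \<in> good; p0 x = p0 y; p2 x = p2 y; p3 x = p3 y\<rbrakk>
          \<Longrightarrow> snd x = snd y"
begin

definition outputs :: "'k \<Rightarrow> ('a \<times> 'a) set" where
  "outputs k = (\<lambda>x. (p1 x, p3 x)) ` {x \<in> good. fst x = k}"

text \<open>On \<open>tight\<close> messages, \<open>p1\<close>, \<open>p2\<close> and \<open>p3\<close> are exact functions of the first component.\<close>

definition tight :: "('k \<times> 'a) set" where
  "tight = {x \<in> good. card (outputs (fst x)) = 1}"

lemma finite_good: "finite good"
  using finite_subset[OF good_subset] finite_K finite_M by simp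

lemma tight_subset: "tight \<subseteq> good"
  by (auto simp: tight_def)

lemma finite_tight: "finite tight"
  using finite_subset[OF tight_subset finite_good] .

lemma finite_outputs: "finite (outputs k)"
  using finite_good by (simp add: outputs_def)

text \<open>By \<open>decode_fst\<close> the sets \<open>outputs k\<close> are disjoint, and all lie
  in \<open>M \<times> M\<close>, which has exactly \<open>card K\<close> elements.\<close>

lemma sum_card_outputs: "(\<Sum>k\<in>K. card (outputs k)) \<le> card K"
proof -
  have "(\<Sum>k\<in>K. card (outputs k)) = card (\<Union>k\<in>K. outputs k)"
    using finite_K finite_outputs
    by (intro card_UN_disjoint[symmetric]) (auto simp: outputs_def dest: decode_fst)
  also have "\<dots> \<le> card (M \<times> M)"
  proof (rule card_mono)
    show "(\<Union>k\<in>K. outputs k) \<subseteq> M \<times> M"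
      unfolding outputs_def using p_in_M good_subset by blast
  qed (use finite_M in simp)
  finally show ?thesis
    by (simp add: card_K card_cartesian_product power2_eq_square)
qed

text \<open>The sizes of the sets \<open>outputs k\<close> average at most 1, so each
  \<open>k\<close> with several outputs is paid for by one with none.\<close>

lemma card_multiple_le_card_empty:
  "card {k \<in> K. card (outputs k) \<ge> 2} \<le> card {k \<in> K. outputs k = {}}"
proof -
  have "card K + card {k \<in> K. card (outputs k) \<ge> 2} =
      (\<Sum>k\<in>K. 1 + of_bool (card (outputs k) \<ge> 2))"
    unfolding sum.distrib using finite_K by (simp add: Int_def)
  also have "\<dots> \<le> (\<Sum>k\<in>K. card (outputs k) + of_bool (outputs k = {}))"
    using finite_outputs by (intro sum_mono) (auto simp: Suc_le_eq card_gt_0_iff)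
  also have "\<dots> \<le> card K + card {k \<in> K. outputs k = {}}"
    using finite_K sum_card_outputs by (simp add: sum.distrib Int_def)
  finally show ?thesis by simp
qed

text \<open>If \<open>outputs k\<close> is empty, all of \<open>{k} \<times> M\<close> is bad. Good
  messages that are not tight lie over some \<open>k\<close> with several outputs, and such
  \<open>k\<close> are no more numerous; so their number, too, is at most that of the bad
  messages.\<close>

lemma card_tight: "card (K \<times> M) \<le> card tight + 2 * card (K \<times> M - good)"
proof -
  let ?E = "{k \<in> K. outputs k = {}}" and ?D = "{k \<in> K. card (outputs k) \<ge> 2}"
  have "?E \<times> M \<subseteq> K \<times> M - good"
    by (auto simp: outputs_def)
  then have E: "card (?E \<times> M) \<le> card (K \<times> M - good)"
    using finite_K finite_M by (intro card_mono) auto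
  have "good - tight \<subseteq> ?D \<times> M"
  proof
    fix x assume x: "x \<in> good - tight"
    then have "outputs (fst x) \<noteq> {}"
      unfolding outputs_def by blast
    then have "card (outputs (fst x)) \<noteq> 0"
      using finite_outputs by (metis card_0_eq)
    moreover have "card (outputs (fst x)) \<noteq> 1"
      using x by (simp add: tight_def)
    ultimately have "card (outputs (fst x)) \<ge> 2"
      by simp
    then show "x \<in> ?D \<times> M"
      using x good_subset by (cases x) auto
  qed
  then have "card (good - tight) \<le> card (?D \<times> M)"
    using finite_K finite_M by (intro card_mono) auto
  also have "\<dots> \<le> card (?E \<times> M)"
    using card_multiple_le_card_empty by (simp add: card_cartesian_product)
  finally have D: "card (good - tight) \<le> card (K \<times> M - good)"
    using E by simp
  have "card (K \<times> M) = card tight + card (good - tight) + card (K \<times> M - good)"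
    using card_mono[OF _ good_subset] card_mono[OF finite_good tight_subset] finite_K finite_M
    by (simp add: card_Diff_subset finite_tight finite_good tight_subset good_subset)
  with D show ?thesis by simp
qed

text \<open>The single output fixes \<open>p1\<close> and \<open>p3\<close>; then \<open>p1\<close>
  and the first component fix \<open>p2\<close>.\<close>

lemma tight_cong:
  assumes "x \<in> tight" "y \<in> tight" "fst x = fst y"
  shows "p2 x = p2 y" "p3 x = p3 y"
proof -
  obtain z where "outputs (fst x) = {z}"
    using assms(1) by (auto simp: tight_def card_1_singleton_iff)
  moreover have "(p1 x, p3 x) \<in> outputs (fst x)" "(p1 y, p3 y) \<in> outputs (fst x)"
    using assms tight_subset by (auto simp: outputs_def)
  ultimately have "(p1 x, p3 x) = (p1 y, p3 y)"
    by simp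
  then show "p3 x = p3 y" "p2 x = p2 y"
    using p2_cong[of x y] assms tight_subset by auto
qed

text \<open>A tight message is recovered from \<open>p0\<close>, \<open>p2\<close>,
  \<open>p3\<close>: these give the second component, which with \<open>p0\<close> gives
  \<open>p1\<close>, and \<open>p1\<close>, \<open>p3\<close> give the first. The pair
  \<open>(p2, p3)\<close> is kept together because its image is bounded separately.\<close>

lemma card_tight_le: "card tight \<le> card M * card ((\<lambda>x. (p2 x, p3 x)) ` tight)"
proof -
  have "inj_on (\<lambda>x. (p0 x, p2 x, p3 x)) tight"
  proof (rule inj_onI)
    fix x y assume xy: "x \<in> tight" "y \<in> tight" "(p0 x, p2 x, p3 x) = (p0 y, p2 y, p3 y)"
    then have "snd x = snd y"
      using decode_snd tight_subset by blast
    moreover from this have "p1 x = p1 y"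
      using xy p1_cong tight_subset by blast
    then have "fst x = fst y"
      using xy decode_fst tight_subset by blast
    ultimately show "x = y"
      by (simp add: prod_eq_iff)
  qed
  moreover have "(\<lambda>x. (p0 x, p2 x, p3 x)) ` tight \<subseteq> M \<times> (\<lambda>x. (p2 x, p3 x)) ` tight"
    using p_in_M good_subset tight_subset by blast
  ultimately have "card tight \<le> card (M \<times> (\<lambda>x. (p2 x, p3 x)) ` tight)"
    using finite_M finite_tight by (intro card_inj_on_le) auto
  then show ?thesis
    by (simp add: card_cartesian_product)
qed

text \<open>First components in \<open>?Kb\<close> give at most \<open>card M\<close> pairs, since
  for fixed \<open>b\<close> the value of \<open>p3\<close> is a function of \<open>p2\<close>.
  Every other first component gives at most one pair.\<close>

lemma card_pairs_le:
  assumes "b \<in> M"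
  shows "card ((\<lambda>x. (p2 x, p3 x)) ` tight) + card {k. (k, b) \<in> tight} \<le> card M + card K"
proof -
  let ?Kb = "{k. (k, b) \<in> tight}" and ?pair = "\<lambda>x. (p2 x, p3 x)"
  have Kb: "?Kb \<subseteq> K"
    using good_subset tight_subset by auto
  \<comment> \<open>On \<open>A\<close> the second component is a function of the first, as \<open>A\<close> is realised with the fixed \<open>b\<close>.\<close>
  define A where "A = ?pair ` {x \<in> tight. fst x \<in> ?Kb}"
  define B where "B = ?pair ` {x \<in> tight. fst x \<notin> ?Kb}"
  have "A \<subseteq> (\<lambda>k. ?pair (k, b)) ` ?Kb"
  proof
    fix z assume "z \<in> A"
    then obtain x where x: "z = ?pair x" "x \<in> tight" "(fst x, b) \<in> tight"
      by (auto simp: A_def)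
    then have "?pair x = ?pair (fst x, b)"
      using tight_cong[of x "(fst x, b)"] by simp
    with x show "z \<in> (\<lambda>k. ?pair (k, b)) ` ?Kb"
      by blast
  qed
  then have A_sub: "A \<subseteq> ?pair ` {x \<in> tight. snd x = b}"
    by force
  have "inj_on fst A"
  proof (rule inj_onI)
    fix z w assume "z \<in> A" "w \<in> A" "fst z = fst w"
    moreover obtain x where "z = ?pair x" "x \<in> tight" "snd x = b"
      using A_sub \<open>z \<in> A\<close> by blast
    moreover obtain y where "w = ?pair y" "y \<in> tight" "snd y = b"
      using A_sub \<open>w \<in> A\<close> by blast
    ultimately show "z = w"
      using p3_cong[of x y] tight_subset by auto
  qed
  moreover have "fst ` A \<subseteq> M"
    using p_in_M good_subset tight_subset unfolding A_def by auto
  ultimately have card_A: "card A \<le> card M"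
    using finite_M by (rule card_inj_on_le)
  \<comment> \<open>The choice is harmless: by \<open>tight_cong\<close> all tight messages over
    \<open>k\<close> give the same pair.\<close>
  define rep where "rep = (\<lambda>k. ?pair (SOME x. x \<in> tight \<and> fst x = k))"
  have "B \<subseteq> rep ` (K - ?Kb)"
  proof
    fix z assume "z \<in> B"
    then obtain x where x: "z = ?pair x" "x \<in> tight" "(fst x, b) \<notin> tight"
      by (auto simp: B_def)
    let ?y = "SOME y. y \<in> tight \<and> fst y = fst x"
    have y: "?y \<in> tight \<and> fst ?y = fst x"
      using x(2) by (intro someI) auto
    then have "z = rep (fst x)"
      using tight_cong[of x ?y] x by (simp add: rep_def)
    moreover have "fst x \<in> K - ?Kb"
      using x good_subset tight_subset by auto
    ultimately show "z \<in> rep ` (K - ?Kb)"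
      by blast
  qed
  then have "card B \<le> card (K - ?Kb)"
    using finite_K by (meson card_image_le card_mono finite_Diff finite_imageI le_trans)
  also have "\<dots> = card K - card ?Kb"
    using Kb finite_subset[OF Kb finite_K] by (simp add: card_Diff_subset)
  finally have "card B + card ?Kb \<le> card K"
    using card_mono[OF finite_K Kb] by simp
  moreover have "?pair ` tight = A \<union> B"
    by (auto simp: A_def B_def)
  then have "card (?pair ` tight) \<le> card A + card B"
    by (simp add: card_Un_le)
  ultimately show ?thesis
    using card_A by simp
qed

text \<open>\<open>card tight\<close> is bounded once through the pairs and once through a large
  fibre. In the sum of the two bounds the unknown fibre size cancels, so barely more than half of
  all messages can be tight.\<close>

lemma card_bad_lower_bound:
  "card M ^ 3 \<le> card M ^ 2 + 4 * card (K \<times> M - good)"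
proof -
  let ?N = "card M" and ?Q = "(\<lambda>x. (p2 x, p3 x)) ` tight"
  obtain b where b: "b \<in> M" "card tight \<le> ?N * card {k. (k, b) \<in> tight}"
    using exists_large_fibre[OF finite_M M_nonempty finite_K, of tight] good_subset tight_subset
    by blast
  have "card tight + card tight \<le> ?N * (card ?Q + card {k. (k, b) \<in> tight})"
    using b(2) card_tight_le by (simp add: distrib_left)
  also have "\<dots> \<le> ?N * (?N + card K)"
    using card_pairs_le[OF b(1)] by simp
  also have "\<dots> = ?N ^ 2 + ?N ^ 3"
    by (simp add: card_K power2_eq_square power3_eq_cube distrib_left)
  finally have "2 * card tight \<le> ?N ^ 2 + ?N ^ 3"
    by simp
  moreover have "card (K \<times> M) = ?N ^ 3"
    by (simp add: card_cartesian_product card_K power2_eq_square power3_eq_cube)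
  ultimately show ?thesis
    using card_tight by simp
qed

end

section \<open>Codes and saturating flows on general networks\<close>

lemma (in network) carried_cong:
  assumes "e \<in> arcs G"
    and "\<And>e'. e' \<in> in_arcs G (tail G e) \<Longrightarrow> carried G n s C m e' = carried G n s C m' e'"
    and "\<And>i. i \<in> observed n s (tail G e) \<Longrightarrow> m i = m' i"
  shows "carried G n s C m e = carried G n s C m' e"
proof -
  have "carried G n s C m e = enc C e (restrict (carried G n s C m) (in_arcs G (tail G e)))
          (restrict m (observed n s (tail G e)))" for m
    using transmits_carried[of n s C m] assms(1) by (auto simp: transmits_def)
  moreover have "restrict (carried G n s C m) (in_arcs G (tail G e)) =
      restrict (carried G n s C m') (in_arcs G (tail G e))"
    using assms(2) by (rule restrict_ext)
  moreover have "restrict m (observed n s (tail G e)) = restrict m' (observed n s (tail G e))"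
    using assms(3) by (rule restrict_ext)
  ultimately show ?thesis by simp
qed

text \<open>Induction along the arcs, because \<open>is_code\<close> constrains an encoder only on
  inputs that are already blocks.\<close>

lemma (in network) carried_in_blocks:
  assumes code: "is_code G n s X T C" and m: "\<And>i. i < n \<Longrightarrow> m i \<in> blocks X T"
    and "e \<in> arcs G"
  shows "carried G n s C m e \<in> blocks X T"
  using assms(3)
proof (induction e rule: wf_induct_rule[OF wf_inv_image[OF wf_arcs_ends, of "tail G"]])
  case (1 e)
  let ?y = "carried G n s C m" and ?v = "tail G e"
  have "?y e' \<in> blocks X T" if "e' \<in> in_arcs G ?v" for e'
  proof (rule 1(1))
    show "(e', e) \<in> inv_image (arcs_ends G) (tail G)" "e' \<in> arcs G"
      using that by (auto simp: arcs_ends_conv image_iff)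
  qed
  then have "restrict ?y (in_arcs G ?v) \<in> in_arcs G ?v \<rightarrow>\<^sub>E blocks X T"
    by auto
  moreover have "restrict m (observed n s ?v) \<in> observed n s ?v \<rightarrow>\<^sub>E blocks X T"
    using m by (auto simp: observed_def)
  ultimately have "enc C e (restrict ?y (in_arcs G ?v)) (restrict m (observed n s ?v)) \<in> blocks X T"
    using code 1(2) by (auto simp: is_code_def)
  then show ?case
    using transmits_carried[of n s C m] 1(2) by (auto simp: transmits_def)
qed

text \<open>With unit capacities and no arcs into \<open>u\<close>, the out-degree of
  \<open>u\<close> bounds every flow value.\<close>

lemma max_flow_eqI:
  assumes "in_arcs G u = {}" "finite (arcs G)" "is_flow G u v f"
    and "flow_value G u f = real (card (out_arcs G u))"
  shows "max_flow G u v = real (card (out_arcs G u))"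
  unfolding max_flow_def
proof (rule cSup_eq_maximum)
  show "real (card (out_arcs G u)) \<in> {flow_value G u f | f. is_flow G u v f}"
    using assms by force
next
  fix x assume "x \<in> {flow_value G u f | f. is_flow G u v f}"
  then obtain g where g: "x = flow_value G u g" "is_flow G u v g"
    by blast
  then have "sum g (out_arcs G u) \<le> (\<Sum>e\<in>out_arcs G u. 1)"
    by (intro sum_mono) (auto simp: is_flow_def)
  with g assms(1) show "x \<le> real (card (out_arcs G u))"
    by (simp add: flow_value_def)
qed

section \<open>The network and its connectivity level\<close>

text \<open>Vertices 0 and 1 are the sources and 10 and 11 the terminals. The bottlenecks \<open>p0, \<dots>, p3\<close> are
  the arcs 5, 6, 7, 8, which lead from 2, 4, 6, 8 to 3, 5, 7, 9; the heads of the bottlenecks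
  duplicate what they receive.\<close>

definition net_tails :: "nat list" where
  "net_tails = [0, 0, 1, 1, 1, 2, 4, 6, 8, 3, 3, 5, 5, 7, 7, 9, 9]"

definition net_heads :: "nat list" where
  "net_heads = [2, 6, 2, 4, 8, 3, 5, 7, 9, 4, 11, 6, 10, 8, 11, 10, 11]"

definition net :: "(nat, nat) pre_digraph" where
  "net = \<lparr>verts = {..<12}, arcs = {..<17}, tail = (!) net_tails, head = (!) net_heads\<rparr>"

definition net_source :: "nat \<Rightarrow> nat" where
  "net_source i = (if i = 1 then 1 else 0)"

definition net_terminal :: "nat \<Rightarrow> nat" where
  "net_terminal i = (if i = 1 then 11 else 10)"

lemma arcs_net: "arcs net = set [0..<17]"
  by (auto simp: net_def)

lemma verts_net: "verts net = set [0..<12]"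
  by (auto simp: net_def)

lemma tail_net: "tail net e = net_tails ! e" and head_net: "head net e = net_heads ! e"
  by (simp_all add: net_def)

lemma in_arcs_net: "in_arcs net v = set (filter (\<lambda>e. net_heads ! e = v) [0..<17])"
  by (auto simp: in_arcs_def net_def)

lemma out_arcs_net: "out_arcs net v = set (filter (\<lambda>e. net_tails ! e = v) [0..<17])"
  by (auto simp: out_arcs_def net_def)

lemmas net_simps = arcs_net verts_net tail_net head_net in_arcs_net out_arcs_net
  net_tails_def net_heads_def upt_rec

lemma in_arcs_net_values:
  "in_arcs net 0 = {}" "in_arcs net 1 = {}" "in_arcs net 2 = {0, 2}" "in_arcs net 3 = {5}"
  "in_arcs net 4 = {3, 9}" "in_arcs net 5 = {6}" "in_arcs net 6 = {1, 11}" "in_arcs net 7 = {7}"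
  "in_arcs net 8 = {4, 13}" "in_arcs net 9 = {8}" "in_arcs net 10 = {12, 15}"
  "in_arcs net 11 = {10, 14, 16}"
  by (simp_all add: net_simps numeral_eq_Suc)

interpretation net: network net
proof
  show "finite (verts net)" "finite (arcs net)"
    by (simp_all add: net_def)
  \<comment> \<open>The vertex numbering is a topological order.\<close>
  have ends: "tail net e < head net e \<and> head net e < 12" if "e \<in> arcs net" for e
    using that by (auto simp: net_simps)
  then show "tail net e \<in> verts net" "head net e \<in> verts net" if "e \<in> arcs net" for e
    using that by (force simp: net_def)+
  have "arcs_ends net \<subseteq> {(u, v). u < v}"
    using ends by (auto simp: arcs_ends_conv)
  then show "acyclic (arcs_ends net)"
    using acyclic_subset wf_acyclic[OF wf_less] by blast
qed

lemma multiple_unicast_net: "multiple_unicast net 3 net_source net_terminal"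
  by unfold_locales (auto simp: net_simps net_source_def net_terminal_def)

lemma out_arcs_net_values:
  "out_arcs net 0 = {0, 1}" "out_arcs net 1 = {2, 3, 4}" "out_arcs net 2 = {5}"
  "out_arcs net 3 = {9, 10}" "out_arcs net 4 = {6}" "out_arcs net 5 = {11, 12}"
  "out_arcs net 6 = {7}" "out_arcs net 7 = {13, 14}" "out_arcs net 8 = {8}"
  "out_arcs net 9 = {15, 16}" "out_arcs net 10 = {}" "out_arcs net 11 = {}"
  by (simp_all add: net_simps numeral_eq_Suc)

lemma is_flow_net:
  assumes "length fs = 17" "set fs \<subseteq> {0, 1}"
    and "\<forall>w\<in>{0, 1, 2, 3, 4, 5, 6, 7, 8, 9, 10, 11}. w \<notin> {u, v} \<longrightarrow>
      sum ((!) fs) (in_arcs net w) = sum ((!) fs) (out_arcs net w)"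
  shows "is_flow net u v ((!) fs)"
  unfolding is_flow_def
proof
  have "fs ! e \<in> {0, 1}" if "e \<in> arcs net" for e
    using that assms(1) by (intro subsetD[OF assms(2)] nth_mem) (simp add: net_def)
  then show "\<forall>e\<in>arcs net. 0 \<le> fs ! e \<and> fs ! e \<le> 1"
    by force
  have "verts net = {0, 1, 2, 3, 4, 5, 6, 7, 8, 9, 10, 11}"
    by (auto simp: net_def numeral_eq_Suc less_Suc_eq)
  with assms(3) show "\<forall>w\<in>verts net - {u, v}.
      sum ((!) fs) (in_arcs net w) = sum ((!) fs) (out_arcs net w)"
    by blast
qed

lemma max_flow_net_0: "max_flow net 0 10 = 2"
proof -
  \<comment> \<open>Two arc-disjoint paths: 0-2-3-4-5-10 and 0-6-7-8-9-10.\<close>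
  let ?f = "(!) [1, 1, 0, 0, 0, 1, 1, 1, 1, 1, 0, 0, 1, 1, 0, 1, 0 :: real]"
  have "is_flow net 0 10 ?f"
    by (rule is_flow_net)
      \<comment> \<open>Simplification turns vertex \<open>1\<close> into \<open>Suc 0\<close>, so
        its arc sets are also supplied in that form.\<close>
      (simp_all add: in_arcs_net_values out_arcs_net_values
        in_arcs_net_values(2)[unfolded One_nat_def] out_arcs_net_values(2)[unfolded One_nat_def])
  moreover have "flow_value net 0 ?f = 2"
    by (simp add: flow_value_def in_arcs_net_values out_arcs_net_values)
  moreover have "card (out_arcs net 0) = 2"
    by (simp add: out_arcs_net_values)
  ultimately show ?thesis
    using max_flow_eqI[of net 0 10 ?f] in_arcs_net_values(1) net.finite_arcs by simp
qed

lemma max_flow_net_1: "max_flow net 1 11 = 3"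
proof -
  \<comment> \<open>Three arc-disjoint paths: 1-2-3-11, 1-4-5-6-7-11 and 1-8-9-11.\<close>
  let ?f = "(!) [0, 0, 1, 1, 1, 1, 1, 1, 1, 0, 1, 1, 0, 0, 1, 0, 1 :: real]"
  have "is_flow net 1 11 ?f"
    by (rule is_flow_net)
      (simp_all add: in_arcs_net_values out_arcs_net_values
        in_arcs_net_values(2)[unfolded One_nat_def] out_arcs_net_values(2)[unfolded One_nat_def])
  moreover have "flow_value net 1 ?f = 3"
    unfolding flow_value_def in_arcs_net_values out_arcs_net_values by simp
  moreover have "card (out_arcs net 1) = 3"
    unfolding out_arcs_net_values by simp
  ultimately show ?thesis
    using max_flow_eqI[of net 1 11 ?f] in_arcs_net_values(2) net.finite_arcs by simp
qed

lemma connectivity_level_net: "connectivity_level net 3 net_source net_terminal = [2, 3, 2]"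
  using max_flow_net_0 max_flow_net_1
  by (simp add: connectivity_level_def upt_rec net_source_def net_terminal_def)

section \<open>Codes on this network as coding schemes\<close>

definition net_messages :: "(nat list \<times> nat list) \<times> nat list \<Rightarrow> nat \<Rightarrow> nat list" where
  "net_messages x = (\<lambda>i\<in>{..<3}. if i = 0 then fst (fst x) else if i = 1 then snd x else snd (fst x))"

lemma net_messages_apply:
  "net_messages x 0 = fst (fst x)" "net_messages x 1 = snd x" "net_messages x 2 = snd (fst x)"
  by (simp_all add: net_messages_def)

lemma lessThan_3: "{..<3} = {0, 1, 2 :: nat}"
  by (auto simp: numeral_eq_Suc less_Suc_eq)

text \<open>Sessions 1, 2, 3 of the overview have indices 0, 1, 2, so \<open>fst x\<close> holds
  messages 0 and 2. The value \<open>undefined\<close> outside \<open>{..<3}\<close> agrees with the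
  default in \<open>message_pmf\<close>.\<close>

lemma bij_betw_net_messages:
  "bij_betw net_messages ((M \<times> M) \<times> M) ({..<3} \<rightarrow>\<^sub>E M)"
proof (rule bij_betw_byWitness[where f' = "\<lambda>m. ((m 0, m 2), m 1)"])
  show "\<forall>x\<in>(M \<times> M) \<times> M.
      ((net_messages x 0, net_messages x 2), net_messages x 1) = x"
    unfolding net_messages_apply by simp
  show "\<forall>m\<in>{..<3} \<rightarrow>\<^sub>E M. net_messages ((m 0, m 2), m 1) = m"
  proof
    fix m :: "nat \<Rightarrow> nat list" assume m: "m \<in> {..<3} \<rightarrow>\<^sub>E M"
    have "net_messages ((m 0, m 2), m 1) i = m i" for i
    proof (cases "i < 3")
      case True
      then have "i = 0 \<or> i = 1 \<or> i = 2"
        by linarith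
      then show ?thesis
        by (elim disjE) (simp_all only: net_messages_apply fst_conv snd_conv)
    next
      case False
      then show ?thesis
        using PiE_arb[OF m, of i] by (simp add: net_messages_def)
    qed
    then show "net_messages ((m 0, m 2), m 1) = m" ..
  qed
  show "net_messages ` ((M \<times> M) \<times> M) \<subseteq> {..<3} \<rightarrow>\<^sub>E M"
  proof (intro image_subsetI PiE_I)
    fix x i assume x: "x \<in> (M \<times> M) \<times> M"
    show "net_messages x i \<in> M" if "i \<in> {..<3}"
      using that x by (auto simp: net_messages_def)
    show "net_messages x i = undefined" if "i \<notin> {..<3}"
      using that by (simp add: net_messages_def)
  qed
  show "(\<lambda>m :: nat \<Rightarrow> nat list. ((m 0, m 2), m 1)) ` ({..<3} \<rightarrow>\<^sub>E M) \<subseteq> (M \<times> M) \<times> M"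
  proof (rule image_subsetI)
    fix m :: "nat \<Rightarrow> nat list" assume m: "m \<in> {..<3} \<rightarrow>\<^sub>E M"
    have "m 0 \<in> M" "m 1 \<in> M" "m 2 \<in> M"
      by (rule PiE_mem[OF m]; simp)+
    then show "((m 0, m 2), m 1) \<in> (M \<times> M) \<times> M"
      by simp
  qed
qed

context
  fixes X :: "nat set" and T :: nat and C :: "nat code"
  assumes finite_X: "finite X" and code: "is_code net 3 net_source X T C"
begin

private abbreviation "M \<equiv> blocks X T"

private abbreviation "y x \<equiv> carried net 3 net_source C (net_messages x)"

private definition "decoded m \<longleftrightarrow>
  (\<forall>i<3. dec C i (restrict (carried net 3 net_source C m) (in_arcs net (net_terminal i))) = m i)"

private definition "good = {x \<in> (M \<times> M) \<times> M. decoded (net_messages x)}"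

lemma finite_blocks: "finite M"
  using finite_lists_length_eq[OF finite_X] by (simp add: blocks_def)

private lemma observed_net:
  "observed 3 net_source v = (if v = 0 then {0, 2} else if v = 1 then {1} else {})"
proof -
  have "observed 3 net_source v = {i \<in> {..<3}. net_source i = v}"
    by (auto simp: observed_def)
  then show ?thesis
    unfolding lessThan_3 by (auto simp: net_source_def)
qed

private lemma y_cong_inner:
  assumes "e \<in> arcs net" "tail net e \<ge> 2" "\<And>e'. e' \<in> in_arcs net (tail net e) \<Longrightarrow> y x e' = y x' e'"
  shows "y x e = y x' e"
  by (rule net.carried_cong) (use assms in \<open>auto simp: observed_net\<close>)

private lemma y_cong_source:
  assumes "e \<in> arcs net" "in_arcs net (tail net e) = {}"
    and "\<And>i. i \<in> observed 3 net_source (tail net e) \<Longrightarrow> net_messages x i = net_messages x' i"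
  shows "y x e = y x' e"
  by (rule net.carried_cong) (use assms in simp_all)

private lemma y_cong_fst:
  assumes "fst x = fst x'" "e \<in> {0, 1}"
  shows "y x e = y x' e"
proof (rule y_cong_source)
  have tail: "tail net e = 0"
    using assms(2) by (auto simp: tail_net net_tails_def)
  then show "in_arcs net (tail net e) = {}"
    by (simp add: in_arcs_net_values)
  show "e \<in> arcs net"
    using assms(2) by (auto simp: net_def)
  fix i assume "i \<in> observed 3 net_source (tail net e)"
  then have "i = 0 \<or> i = 2"
    by (simp add: tail observed_net)
  then show "net_messages x i = net_messages x' i"
    using assms(1) by (auto simp: net_messages_apply)
qed

private lemma y_cong_snd:
  assumes "snd x = snd x'" "e \<in> {2, 3, 4}"
  shows "y x e = y x' e"
proof (rule y_cong_source)
  have tail: "tail net e = 1"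
    using assms(2) by (auto simp: tail_net net_tails_def)
  then show "in_arcs net (tail net e) = {}"
    by (simp only: in_arcs_net_values)
  show "e \<in> arcs net"
    using assms(2) by (auto simp: net_def)
  fix i assume "i \<in> observed 3 net_source (tail net e)"
  then have "i = 1"
    by (simp add: tail observed_net)
  then show "net_messages x i = net_messages x' i"
    using assms(1) by (simp only: net_messages_apply)
qed

text \<open>The tail of each arc 9 to 16 observes no message and has one bottleneck as its only
  incoming arc. Whatever it sends is a function of that bottleneck, whether or not the code
  duplicates symbols.\<close>

private lemma y_branch:
  "y x 5 = y x' 5 \<Longrightarrow> y x 9 = y x' 9"
  "y x 5 = y x' 5 \<Longrightarrow> y x 10 = y x' 10"
  "y x 6 = y x' 6 \<Longrightarrow> y x 11 = y x' 11"
  "y x 6 = y x' 6 \<Longrightarrow> y x 12 = y x' 12"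
  "y x 7 = y x' 7 \<Longrightarrow> y x 13 = y x' 13"
  "y x 7 = y x' 7 \<Longrightarrow> y x 14 = y x' 14"
  "y x 8 = y x' 8 \<Longrightarrow> y x 15 = y x' 15"
  "y x 8 = y x' 8 \<Longrightarrow> y x 16 = y x' 16"
  by (rule y_cong_inner; auto simp: arcs_net tail_net net_tails_def in_arcs_net_values simp del: in_in_arcs_conv)+

private lemma decode_cong:
  assumes "x \<in> good" "x' \<in> good" "i < 3"
    and "\<And>e. e \<in> in_arcs net (net_terminal i) \<Longrightarrow> y x e = y x' e"
  shows "net_messages x i = net_messages x' i"
proof -
  have "restrict (y x) (in_arcs net (net_terminal i)) = restrict (y x') (in_arcs net (net_terminal i))"
    using assms(4) by (rule restrict_ext)
  then show ?thesis
    using assms(1-3) by (simp add: good_def decoded_def) metis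
qed

text \<open>Each bottleneck 6, 7, 8 has two arcs into its tail: one directly from a source, one
  branching off the previous bottleneck. Terminal 10 sees branches of 6 and 8, terminal 11 those of
  5, 7 and 8.\<close>

private lemma coding_scheme_net:
  assumes "M \<noteq> {}"
  shows "coding_scheme (M \<times> M) M good (\<lambda>x. y x 5) (\<lambda>x. y x 6) (\<lambda>x. y x 7) (\<lambda>x. y x 8)"
proof
  show "finite (M \<times> M)" "finite M"
    using finite_blocks by simp_all
  show "card (M \<times> M) = card M ^ 2"
    by (simp add: card_cartesian_product power2_eq_square)
  show "good \<subseteq> (M \<times> M) \<times> M"
    by (auto simp: good_def)
  show "y x 5 \<in> M \<and> y x 6 \<in> M \<and> y x 7 \<in> M \<and> y x 8 \<in> M" if "x \<in> (M \<times> M) \<times> M" for x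
    using that by (intro conjI net.carried_in_blocks[OF code]) (auto simp: net_messages_def net_def)
  fix x x' assume good: "x \<in> good" "x' \<in> good"
  show "y x 6 = y x' 6" if "y x 5 = y x' 5" "snd x = snd x'"
    by (rule y_cong_inner)
      (use y_branch(1)[OF that(1)] y_cong_snd[OF that(2), of 3]
        in \<open>auto simp: arcs_net tail_net net_tails_def in_arcs_net_values simp del: in_in_arcs_conv\<close>)
  show "y x 7 = y x' 7" if "y x 6 = y x' 6" "fst x = fst x'"
    by (rule y_cong_inner)
      (use y_branch(3)[OF that(1)] y_cong_fst[OF that(2), of 1]
        in \<open>auto simp: arcs_net tail_net net_tails_def in_arcs_net_values simp del: in_in_arcs_conv\<close>)
  show "y x 8 = y x' 8" if "y x 7 = y x' 7" "snd x = snd x'"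
    by (rule y_cong_inner)
      (use y_branch(5)[OF that(1)] y_cong_snd[OF that(2), of 4]
        in \<open>auto simp: arcs_net tail_net net_tails_def in_arcs_net_values simp del: in_in_arcs_conv\<close>)
  show "fst x = fst x'" if "y x 6 = y x' 6" "y x 8 = y x' 8"
  proof -
    have "net_messages x i = net_messages x' i" if "i \<in> {0, 2}" for i
      by (rule decode_cong[OF good])
        (use that y_branch(4)[OF \<open>y x 6 = y x' 6\<close>] y_branch(7)[OF \<open>y x 8 = y x' 8\<close>]
          in \<open>auto simp: net_terminal_def in_arcs_net_values simp del: in_in_arcs_conv\<close>)
    from this[of 0] this[of 2] show ?thesis
      by (simp add: net_messages_apply prod_eq_iff)
  qed
  show "snd x = snd x'" if "y x 5 = y x' 5" "y x 7 = y x' 7" "y x 8 = y x' 8"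
  proof -
    have "net_messages x 1 = net_messages x' 1"
      by (rule decode_cong[OF good])
        (use y_branch(2)[OF that(1)] y_branch(6)[OF that(2)] y_branch(8)[OF that(3)]
          in \<open>auto simp: net_terminal_def in_arcs_net_values simp del: in_in_arcs_conv\<close>)
    then show ?thesis
      by (simp only: net_messages_apply)
  qed
qed (use assms in auto)

lemma error_prob_net_ge:
  assumes "card X \<ge> 2" "T \<ge> 1"
  shows "error_prob net 3 net_source net_terminal X T C \<ge> 1 / 8"
proof -
  let ?N = "card M" and ?W = "{..<3::nat} \<rightarrow>\<^sub>E M" and ?bad = "(M \<times> M) \<times> M - good"
  have N: "?N = card X ^ T"
    using card_lists_length_eq[OF finite_X] by (simp add: blocks_def)
  have "card X ^ 1 \<le> card X ^ T"
    using assms by (intro power_increasing) auto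
  then have N2: "?N \<ge> 2"
    using assms N by simp
  then have "M \<noteq> {}"
    by auto
  interpret coding_scheme "M \<times> M" M good "\<lambda>x. y x 5" "\<lambda>x. y x 6" "\<lambda>x. y x 7" "\<lambda>x. y x 8"
    by (rule coding_scheme_net) fact
  have W: "finite ?W" "?W \<noteq> {}" "card ?W = ?N ^ 3"
    using finite_blocks \<open>M \<noteq> {}\<close> by (auto simp: finite_PiE card_PiE PiE_eq_empty_iff)
  have pmf: "message_pmf 3 X T = pmf_of_set ?W"
  proof -
    \<comment> \<open>Independent uniform messages amount to one uniform choice from
      \<open>?W\<close>, so the error probability is a ratio of cardinalities.\<close>
    have "PiE_dflt {..<3::nat} undefined (\<lambda>_. M) = ?W"
      by (auto simp: PiE_dflt_def PiE_iff extensional_def)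
    then show ?thesis
      using finite_blocks \<open>M \<noteq> {}\<close> by (simp add: message_pmf_def Pi_pmf_of_set)
  qed
  have "?W \<inter> {m. \<not> decoded m} = net_messages ` ?bad"
    using bij_betw_imp_surj_on[OF bij_betw_net_messages[of M]] by (auto simp: good_def)
  moreover have "inj_on net_messages ?bad"
    using bij_betw_net_messages[of M] by (auto simp: bij_betw_def intro: inj_on_subset)
  ultimately have bad: "card (?W \<inter> {m. \<not> decoded m}) = card ?bad"
    by (simp add: card_image)
  have "error_prob net 3 net_source net_terminal X T C =
      measure_pmf.prob (pmf_of_set ?W) {m. \<not> decoded m}"
    by (simp add: error_prob_def pmf decoded_def)
  also have "\<dots> = card ?bad / ?N ^ 3"
    using W by (simp add: measure_pmf_of_set bad)
  finally have err: "error_prob net 3 net_source net_terminal X T C = card ?bad / ?N ^ 3" .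
  \<comment> \<open>Two or more blocks make the square at most half the cube, which turns the
    counting bound into 1/8.\<close>
  have "?N ^ 2 * 2 \<le> ?N ^ 2 * ?N"
    using N2 by (intro mult_left_mono) auto
  then have "?N ^ 2 * 2 \<le> ?N ^ 3"
    by (simp only: power2_eq_square power3_eq_cube mult.assoc)
  then have "?N ^ 3 \<le> 8 * card ?bad"
    using card_bad_lower_bound by linarith
  then have "real (?N ^ 3) \<le> real (8 * card ?bad)"
    by (rule of_nat_mono)
  then show ?thesis
    using N2 by (simp add: err field_simps)
qed

end

lemma infeasible_net: "infeasible net 3 net_source net_terminal"
  unfolding infeasible_def
proof (intro allI impI notI; elim conjE exE)
  fix X :: "nat set" and T :: "nat \<Rightarrow> nat" and C :: "nat \<Rightarrow> nat code"
  assume X: "finite X" "2 \<le> card X"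
    and T: "filterlim T at_top sequentially"
    and C: "\<forall>k. is_code net 3 net_source X (T k) (C k)"
    and lim: "(\<lambda>k. error_prob net 3 net_source net_terminal X (T k) (C k)) \<longlonglongrightarrow> 0"
  \<comment> \<open>Length 0 must be excluded: it leaves a single block, and no error is
    forced.\<close>
  have "\<forall>\<^sub>F k in sequentially. T k \<ge> 1"
    using T by (simp add: filterlim_at_top)
  moreover have "\<forall>\<^sub>F k in sequentially. error_prob net 3 net_source net_terminal X (T k) (C k) < 1 / 8"
    using lim by (rule order_tendstoD) simp
  ultimately have "\<forall>\<^sub>F k in sequentially. False"
  proof eventually_elim
    case (elim k)
    then show ?case
      using error_prob_net_ge[of X "T k" "C k"] X C by simp
  qed
  then show False by simp
qed

theorem mainTheorem4:
  shows "\<exists>(G :: (nat, nat) pre_digraph) (s :: nat \<Rightarrow> nat) (t :: nat \<Rightarrow> nat).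
           multiple_unicast G 3 s t \<and>
           connectivity_level G 3 s t = [2, 3, 2] \<and>
           infeasible G 3 s t"
  using multiple_unicast_net connectivity_level_net infeasible_net by blast

end
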